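(* Let $A\in\mathbb{R}_{\min}^{n\times n}$ be a min-plus matrix, and let $$\hat g_A(x)=x^n\oplus c_1\otimes x^{n-1}\oplus\cdots\oplus c_{n-1}\otimes x\oplus c_n$$ be the min-plus polynomial whose coefficients are given recursively by $c_1=\mathrm{Tr}(A)$ and $$c_m=\mathrm{Tr}\left(A^m\oplus c_1\otimes A^{m-1}\oplus\cdots\oplus c_{m-1}\otimes A\right),\qquad m=2,3,\dots,n.$$ Then the minimum root of $\hat g_A(x)$ is equal to the minimum eigenvalue of $A$.
   Context: Min-plus algebra: $\mathbb{R}_{\min}=\mathbb{R}\cup\{+\infty\}$ with $a\oplus b=\min\{a,b\}$, $a\otimes b=a+b$; $\varepsilon=+\infty$ is the identity for $\oplus$ (and absorbing for $\otimes$), $e=0$ is the identity for $\otimes$. Powers of scalars are with respect to $\otimes$: $x^m=mx$, with $x^0=0$. For matrices, $[A\oplus B]_{ij}=a_{ij}\oplus b_{ij}$, $[A\otimes B]_{ij}=\min_{\ell}\{a_{i\ell}+b_{\ell j}\}$, $[\alpha\otimes A]_{ij}=\alpha\otimes a_{ij}$; $A^1=A$, $A^k=A^{k-1}\otimes A$. The min-plus trace is $\mathrm{Tr}(A)=a_{11}\oplus a_{22}\oplus\cdots\oplus a_{nn}=\min_i a_{ii}$. Eigenvalue: $\lambda\in\mathbb{R}_{\min}$ is an eigenvalue of $A$ if there is $\boldsymbol{x}\in\mathbb{R}_{\min}^n\setminus\{(\varepsilon,\dots,\varepsilon)^{\top}\}$ with $A\otimes\boldsymbol{x}=\lambda\otimes\boldsymbol{x}$.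 Roots: a min-plus polynomial $p(x)=x^n\oplus c_1\otimes x^{n-1}\oplus\cdots\oplus c_n$, regarded as the piecewise linear function $x\mapsto\min\{nx,\,c_1+(n-1)x,\dots,c_{n-1}+x,\,c_n\}$, factorizes as a function uniquely (up to order) into linear factors $(x\oplus r_1)\otimes\cdots\otimes(x\oplus r_n)$ with $r_i\in\mathbb{R}_{\min}$; the $r_i$ are the roots of $p$. The finite roots are exactly the $x$-coordinates of the break points of this function, and a factor $x=x\oplus\varepsilon$ corresponds to the root $\varepsilon$. *)

theory Defs
  imports "HOL-Analysis.Analysis" "HOL-Computational_Algebra.Polynomial"
begin

text \<open>
  The min-plus semiring, as the extended reals without minus infinity, made an instance of
  \<^class>\<open>comm_semiring_1\<close>: \<open>+\<close> is minimum and \<open>*\<close> is ordinary addition, so that \<open>0 :: minplus\<close>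
  is plus infinity, \<open>1 :: minplus\<close> is the real number zero, and \<open>x ^ m\<close> is the real multiple
  \<open>m x\<close>. The order is the usual order of the extended reals, hence \<open>0 :: minplus\<close> is the
  \<^emph>\<open>greatest\<close> element.
\<close>

typedef minplus = "{x :: ereal. x \<noteq> -\<infinity>}"
  morphisms ereal_of_minplus minplus_of_ereal
  by (rule exI[of _ 0]) simp

setup_lifting type_definition_minplus

instantiation minplus :: comm_semiring_1
begin

lift_definition zero_minplus :: minplus is "\<infinity> :: ereal" by simp

lift_definition one_minplus :: minplus is "0 :: ereal" by simp

lift_definition plus_minplus :: "minplus \<Rightarrow> minplus \<Rightarrow> minplus" is "min :: ereal \<Rightarrow> ereal \<Rightarrow> ereal"
  by (simp add: min_def)

lift_definition times_minplus :: "minplus \<Rightarrow> minplus \<Rightarrow> minplus" is "(+) :: ereal \<Rightarrow> ereal \<Rightarrow> ereal"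
  by (auto simp: ereal_plus_eq_MInfty)

instance
proof
  fix a b c :: minplus
  show "a + b + c = a + (b + c)" by transfer (simp add: min.assoc)
  show "a + b = b + a" by transfer (simp add: min.commute)
  show "0 + a = a" by transfer simp
  show "a * b * c = a * (b * c)" by transfer (simp add: add.assoc)
  show "a * b = b * a" by transfer (simp add: add.commute)
  show "1 * a = a" by transfer simp
  show "0 * a = 0" by transfer simp
  show "a * 0 = 0" by transfer simp
  show "(a + b) * c = a * c + b * c"
    by transfer (auto simp: min_def add_right_mono antisym add_mono)
  show "(0 :: minplus) \<noteq> 1" by transfer simp
qed

end

instantiation minplus :: linorder
begin

lift_definition less_eq_minplus :: "minplus \<Rightarrow> minplus \<Rightarrow> bool" is "(\<le>) :: ereal \<Rightarrow> ereal \<Rightarrow> bool" .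

lift_definition less_minplus :: "minplus \<Rightarrow> minplus \<Rightarrow> bool" is "(<) :: ereal \<Rightarrow> ereal \<Rightarrow> bool" .

instance
  by standard (transfer, auto)+

end

lemma plus_minplus_eq_min: "a + b = min a (b :: minplus)"
  unfolding min_def by transfer (simp add: min_def)

lemma ereal_of_minplus_power:
  "ereal_of_minplus (x ^ m) = ereal (real m) * ereal_of_minplus x"
proof (induction m)
  case 0
  then show ?case by (simp add: one_minplus.rep_eq zero_ereal_def[symmetric])
next
  case (Suc m)
  then show ?case
    by (cases "ereal_of_minplus x") (auto simp: times_minplus.rep_eq algebra_simps)
qed

text \<open>
  The product \<open>*\<close> and the power \<open>^\<close> that the library provides on the type of matrices are
  componentwise, hence a separate matrix power.
\<close>

primrec matrix_power :: "minplus ^ 'n ^ 'n \<Rightarrow> nat \<Rightarrow> minplus ^ 'n ^ 'n" where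
  "matrix_power A 0 = mat 1"
| "matrix_power A (Suc k) = matrix_power A k ** A"

lemma matrix_power_1: "matrix_power A 1 = A"
  by simp

definition scale_matrix :: "minplus \<Rightarrow> minplus ^ 'n ^ 'm \<Rightarrow> minplus ^ 'n ^ 'm" where
  "scale_matrix a A = (\<chi> i j. a * A $ i $ j)"

definition eigenvalue :: "minplus ^ 'n ^ 'n \<Rightarrow> minplus \<Rightarrow> bool" where
  "eigenvalue A l \<longleftrightarrow> (\<exists>x. x \<noteq> 0 \<and> A *v x = l *s x)"

text \<open>
  A polynomial is factorized as a \<^emph>\<open>function\<close> (distinct min-plus polynomials may induce the same
  function), into as many linear factors as its degree; the factor with \<open>r = 0\<close>, i.e. plus
  infinity, is the function \<open>x\<close>. The roots are listed with multiplicity in \<open>R\<close>.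
\<close>

definition linear_factorization :: "minplus poly \<Rightarrow> minplus multiset \<Rightarrow> bool" where
  "linear_factorization p R \<longleftrightarrow>
     size R = degree p \<and> (\<forall>x. poly p x = (\<Prod>r\<in>#R. x + r))"

definition root_of :: "minplus poly \<Rightarrow> minplus \<Rightarrow> bool" where
  "root_of p r \<longleftrightarrow> (\<exists>R. linear_factorization p R \<and> r \<in># R)"

text \<open>Only the indices \<open>m \<ge> 1\<close> are meaningful; for \<open>m = 1\<close> the sum is empty.\<close>

function trace_coeff :: "minplus ^ 'n ^ 'n \<Rightarrow> nat \<Rightarrow> minplus" where
  "trace_coeff A m =
     trace (matrix_power A m
       + (\<Sum>k = 1..<m. scale_matrix (trace_coeff A k) (matrix_power A (m - k))))"
  by auto
termination by (relation "Wellfounded.measure snd") auto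

declare trace_coeff.simps [simp del]

lemma trace_coeff_1: "trace_coeff A 1 = trace A"
  by (simp add: trace_coeff.simps[of A "Suc 0"])

definition trace_poly :: "minplus ^ 'n ^ 'n \<Rightarrow> minplus poly" where
  "trace_poly A = monom 1 CARD('n)
     + (\<Sum>m = 1..CARD('n). monom (trace_coeff A m) (CARD('n) - m))"

definition is_minimum :: "'a :: linorder set \<Rightarrow> 'a \<Rightarrow> bool" where
  "is_minimum S m \<longleftrightarrow> m \<in> S \<and> (\<forall>s\<in>S. m \<le> s)"

end

theory Submission
  imports Defs
begin

text \<open>
  Both minima are the least mean weight \<open>\<mu>\<close> of the closed walks of length \<open>m\<close> between \<open>1\<close> and the
  number \<open>n\<close> of vertices, in the weighted digraph of the matrix, an infinite entry standing for
  a missing edge. The trace of the \<open>m\<close>-th power of the matrix is the least weight of a closed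
  walk with \<open>m\<close> steps, so \<open>\<mu>\<close> is the least of the \<open>m\<close>-th roots of these traces, a root being an
  ordinary quotient by \<open>m\<close>.

  The minimum root of a monic polynomial is its first break point, which is the point where
  the leading term \<open>x ^ n\<close> first meets another term \<open>c m * x ^ (n - m)\<close>, that is, the least
  \<open>m\<close>-th root of \<open>c m\<close>; it is infinite if all \<open>c m\<close> are (\<open>minimum_root_eq_least_mean\<close>). Its existence as a root rests on a
  factorization of the polynomial, which is built by splitting off one least root after the
  other (\<open>split_off_least_root\<close>). The coefficients in question differ from the traces, but they
  are least sums of traces over compositions of \<open>m\<close>, and this does not change the least mean
  (\<open>least_mean_trace_coeff\<close>).

  The minimum eigenvalue is the least mean of a closed walk, by the spectral theory of min-plus
  matrices (\<open>minimum_eigenvalue_eq_least_mean\<close>). Following the entries at which the minima in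
  an eigenvalue equation are attained leads into a closed walk whose mean weight is the
  eigenvalue, so no eigenvalue is below \<open>\<mu>\<close>. Conversely, \<open>\<mu>\<close> is an eigenvalue: if it is finite,
  normalized distances to a vertex on a closed walk of mean \<open>\<mu>\<close> form an eigenvector, and if it is
  infinite, the digraph is acyclic and a vertex without predecessors gives one. Lengths up to
  \<open>n\<close> suffice because every walk with \<open>n\<close> steps visits some vertex twice.
\<close>

section \<open>Order and arithmetic of min-plus scalars\<close>

lemma le_zero_minplus [simp]: "a \<le> (0 :: minplus)"
  by transfer simp

lemma zero_le_minplus_iff [simp]: "0 \<le> a \<longleftrightarrow> a = (0 :: minplus)"
  by (auto intro: antisym)

lemma le_add_minplus_iff [simp]: "c \<le> a + b \<longleftrightarrow> c \<le> a \<and> c \<le> (b :: minplus)"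
  by (simp add: plus_minplus_eq_min)

lemma add_minplus_le [simp]: "a + b \<le> a" "a + b \<le> (b :: minplus)"
  by (simp_all add: plus_minplus_eq_min)

lemma mult_minplus_mono: "a * b \<le> c * d" if "a \<le> c" "b \<le> d" for a b c d :: minplus
  using that by transfer (rule add_mono)

lemma mult_minplus_cancel: "a \<le> b" if "a * c \<le> b * c" "c \<noteq> 0" for a b c :: minplus
  using that
proof transfer
  fix a b c :: ereal
  assume "a \<noteq> -\<infinity>" "b \<noteq> -\<infinity>" "c \<noteq> -\<infinity>" "a + c \<le> b + c" "c \<noteq> \<infinity>"
  then show "a \<le> b"
    by (cases a; cases b; cases c) auto
qed

instance minplus :: semiring_1_no_zero_divisors
proof
  fix a b :: minplus
  assume "a \<noteq> 0" "b \<noteq> 0"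
  then show "a * b \<noteq> 0"
    by transfer simp
qed

lemma power_minplus_mono: "a ^ m \<le> b ^ m" if "a \<le> b" for a b :: minplus
  by (induction m) (simp_all add: mult_minplus_mono that)

lemma power_minplus_cancel:
  fixes a b :: minplus
  assumes "a ^ m \<le> b ^ m" "m \<ge> 1"
  shows "a \<le> b"
proof -
  have "ereal (real m) * ereal_of_minplus a \<le> ereal (real m) * ereal_of_minplus b"
    using assms(1) by (simp add: less_eq_minplus.rep_eq ereal_of_minplus_power)
  then have "ereal_of_minplus a \<le> ereal_of_minplus b"
    using assms(2) by (cases "ereal_of_minplus a"; cases "ereal_of_minplus b") auto
  then show ?thesis
    by (simp add: less_eq_minplus.rep_eq)
qed

lemma minplus_root_exists:
  fixes c :: minplus
  assumes "m \<ge> 1"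
  shows "\<exists>x. x ^ m = c"
proof (cases "ereal_of_minplus c")
  case (real r)
  have "ereal_of_minplus (minplus_of_ereal (ereal (r / real m)) ^ m) = ereal_of_minplus c"
    using assms real by (simp add: ereal_of_minplus_power minplus_of_ereal_inverse)
  then show ?thesis
    by (auto simp: ereal_of_minplus_inject)
next
  case PInf
  then have "c = 0"
    by (metis ereal_of_minplus_inject zero_minplus.rep_eq)
  then show ?thesis
    using assms by (intro exI[of _ 0]) simp
next
  case MInf
  then show ?thesis
    using ereal_of_minplus[of c] by simp
qed

text \<open>
  The bound on the quotient is automatic by cancellation unless \<open>a\<close> is infinite; then \<open>c\<close> is
  infinite as well, and the infinite quotient is the one to take.
\<close>

lemma minplus_quotient_exists:
  fixes a c :: minplus
  assumes "a ^ Suc m \<le> c"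
  shows "\<exists>d. d * a = c \<and> a ^ m \<le> d"
proof (cases "a = 0")
  case True
  with assms show ?thesis
    by (intro exI[of _ 0]) simp
next
  case False
  have "\<exists>b. b * a = 1"
    using False
  proof transfer
    fix a :: ereal
    assume "a \<noteq> -\<infinity>" "a \<noteq> \<infinity>"
    then show "\<exists>b\<in>{x. x \<noteq> -\<infinity>}. b + a = 0"
      by (cases a) (auto intro!: exI[of _ "-a"] simp: zero_ereal_def)
  qed
  then obtain b where "b * a = 1" ..
  then have "(c * b) * a = c"
    by (simp add: mult.assoc)
  moreover from this assms False have "a ^ m \<le> c * b"
    by (intro mult_minplus_cancel[of "a ^ m" a]) (simp_all add: mult.commute)
  ultimately show ?thesis
    by blast
qed

lemma minplus_dense: "\<exists>z. a < z \<and> z < b" if "a < b" for a b :: minplus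
  using that
proof transfer
  fix a b :: ereal
  assume "a < b"
  then obtain z where "a < z" "z < b"
    using dense by blast
  then show "\<exists>z\<in>{x. x \<noteq> -\<infinity>}. a < z \<and> z < b"
    by (intro bexI[of _ z]) auto
qed

lemma minplus_prod_nonzero: "prod f S \<noteq> (0 :: minplus)" if "\<And>i. i \<in> S \<Longrightarrow> f i \<noteq> 0"
  using that by (induction S rule: infinite_finite_induct) auto

lemma minplus_sum_le: "sum f S \<le> (f i :: minplus)" if "finite S" "i \<in> S"
  using that by (simp add: sum.remove)

lemma le_minplus_sum_iff: "b \<le> sum f S \<longleftrightarrow> (\<forall>i\<in>S. b \<le> (f i :: minplus))" if "finite S"
  using that by (induction S) auto

lemma minplus_sum_attained: "\<exists>i\<in>S. sum f S = (f i :: minplus)" if "finite S" "S \<noteq> {}"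
  using that by (induction S rule: finite_ne_induct) (auto simp: plus_minplus_eq_min min_def)

section \<open>Least means\<close>

text \<open>
  Since \<open>\<mu> ^ m\<close> is the real multiple \<open>m \<mu>\<close>, this says that \<open>\<mu>\<close> is the minimum of the
  quotients \<open>c m / m\<close> for \<open>1 \<le> m \<le> n\<close>. For the coefficients of a monic polynomial this is the
  first slope of the Newton polygon; for the traces of the powers of a matrix it is the least
  mean weight of a closed walk with at most \<open>n\<close> steps.
\<close>

definition least_mean :: "(nat \<Rightarrow> minplus) \<Rightarrow> nat \<Rightarrow> minplus \<Rightarrow> bool" where
  "least_mean c n \<mu> \<longleftrightarrow> (\<forall>m\<in>{1..n}. \<mu> ^ m \<le> c m) \<and> (\<exists>m\<in>{1..n}. \<mu> ^ m = c m)"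

lemma least_mean_exists:
  assumes "n \<ge> 1"
  shows "\<exists>\<mu>. least_mean c n \<mu>"
proof -
  have "\<exists>\<rho>. \<forall>m\<in>{1..n}. \<rho> m ^ m = c m"
    by (intro bchoice ballI minplus_root_exists) simp
  then obtain \<rho> where \<rho>: "\<forall>m\<in>{1..n}. \<rho> m ^ m = c m" ..
  define \<mu> where "\<mu> = Min (\<rho> ` {1..n})"
  have "\<mu> \<in> \<rho> ` {1..n}"
    unfolding \<mu>_def using assms by (intro Min_in) auto
  then have "\<exists>m\<in>{1..n}. \<mu> ^ m = c m"
    using \<rho> by blast
  moreover have "\<mu> ^ m \<le> c m" if "m \<in> {1..n}" for m
  proof -
    have "\<mu> \<le> \<rho> m"
      unfolding \<mu>_def using that by (intro Min_le) auto
    then have "\<mu> ^ m \<le> \<rho> m ^ m"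
      by (rule power_minplus_mono)
    with \<rho> that show ?thesis
      by simp
  qed
  ultimately show ?thesis
    unfolding least_mean_def by blast
qed

section \<open>Roots of a min-plus polynomial\<close>

definition monic_fun :: "nat \<Rightarrow> (nat \<Rightarrow> minplus) \<Rightarrow> minplus \<Rightarrow> minplus" where
  "monic_fun n c x = x ^ n + (\<Sum>m = 1..n. c m * x ^ (n - m))"

lemma le_monic_fun_iff:
  "b \<le> monic_fun n c x \<longleftrightarrow> b \<le> x ^ n \<and> (\<forall>m\<in>{1..n}. b \<le> c m * x ^ (n - m))"
  by (simp add: monic_fun_def le_minplus_sum_iff)

lemma monic_fun_le:
  "monic_fun n c x \<le> x ^ n"
  "m \<in> {1..n} \<Longrightarrow> monic_fun n c x \<le> c m * x ^ (n - m)"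
  using le_monic_fun_iff[of "monic_fun n c x" n c x] by auto

text \<open>
  To the right of the first break point \<open>\<mu>\<close> the leading term of the polynomial is never needed,
  and to the left of it no other term is. Dividing all the other terms by \<open>\<mu>\<close> and restoring a
  leading term of degree one less therefore gives the quotient by the factor \<open>x + \<mu>\<close>; the
  linear coefficient \<open>c 1\<close> is absorbed because it is at least \<open>\<mu>\<close>.
\<close>

lemma split_off_least_root:
  assumes "least_mean c (Suc n) \<mu>"
  shows "\<exists>d. \<forall>x. monic_fun (Suc n) c x = (x + \<mu>) * monic_fun n d x"
proof -
  have bound: "\<mu> ^ m \<le> c m" if "m \<in> {1..Suc n}" for m
    using assms that by (auto simp: least_mean_def)
  obtain k where k: "k \<in> {1..Suc n}" "\<mu> ^ k = c k"
    using assms by (auto simp: least_mean_def)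
  have "\<exists>d. \<forall>m\<in>{1..n}. d m * \<mu> = c (Suc m) \<and> \<mu> ^ m \<le> d m"
    by (intro bchoice ballI minplus_quotient_exists bound) auto
  then obtain d where d: "d m * \<mu> = c (Suc m)" "\<mu> ^ m \<le> d m" if "m \<in> {1..n}" for m
    by blast
  have "monic_fun (Suc n) c x = (x + \<mu>) * monic_fun n d x" for x
  proof (rule antisym)
    let ?p = "monic_fun (Suc n) c x"
    have "?p \<le> x * x ^ n"
      using monic_fun_le(1)[of "Suc n"] by simp
    moreover have "?p \<le> x * (d m * x ^ (n - m))" if m: "m \<in> {1..n}" for m
    proof (cases "x \<le> \<mu>")
      case True
      have "?p \<le> x ^ m * x ^ (Suc n - m)"
        using monic_fun_le(1)[of "Suc n" c x] m by (simp flip: power_add)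
      also have "\<dots> \<le> d m * x ^ (Suc n - m)"
        using power_minplus_mono[OF True, of m] d(2)[OF m] by (intro mult_minplus_mono) auto
      finally show ?thesis
        using m by (simp add: Suc_diff_le mult_ac)
    next
      case False
      have "?p \<le> c (Suc m) * x ^ (n - m)"
        using monic_fun_le(2)[of "Suc m" "Suc n" c x] m by simp
      also have "\<dots> = \<mu> * (d m * x ^ (n - m))"
        by (simp flip: d(1)[OF m] add: mult_ac)
      also have "\<dots> \<le> x * (d m * x ^ (n - m))"
        using False by (intro mult_minplus_mono) auto
      finally show ?thesis .
    qed
    moreover have "?p \<le> \<mu> * x ^ n"
    proof (cases "x \<le> \<mu>")
      case True
      have "?p \<le> x * x ^ n"
        by fact
      also have "\<dots> \<le> \<mu> * x ^ n"
        using True by (intro mult_minplus_mono) auto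
      finally show ?thesis .
    next
      case False
      obtain j where j: "k = Suc j"
        using k(1) by (cases k) auto
      have "?p \<le> c k * x ^ (Suc n - k)"
        using monic_fun_le(2)[OF k(1)] .
      also have "\<dots> = \<mu> * (\<mu> ^ j * x ^ (n - j))"
        unfolding j k(2)[symmetric, unfolded j] by (simp add: mult.assoc)
      also have "\<dots> \<le> \<mu> * (x ^ j * x ^ (n - j))"
        using False by (intro mult_minplus_mono power_minplus_mono) auto
      also have "\<dots> = \<mu> * x ^ n"
        using k(1) j by (simp flip: power_add)
      finally show ?thesis .
    qed
    moreover have "?p \<le> \<mu> * (d m * x ^ (n - m))" if "m \<in> {1..n}" for m
      using monic_fun_le(2)[of "Suc m" "Suc n" c x] that
      by (simp flip: d(1)[OF that] add: mult_ac)
    ultimately show "?p \<le> (x + \<mu>) * monic_fun n d x"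
      by (simp add: monic_fun_def distrib_left distrib_right sum_distrib_left le_minplus_sum_iff)
  next
    let ?q = "monic_fun n d x"
    have "(x + \<mu>) * ?q \<le> x ^ Suc n"
      using mult_minplus_mono[OF add_minplus_le(1) monic_fun_le(1)] by simp
    moreover have "(x + \<mu>) * ?q \<le> c m * x ^ (Suc n - m)" if m: "m \<in> {1..Suc n}" for m
    proof (cases "m = 1")
      case True
      have "(x + \<mu>) * ?q \<le> c m * x ^ n"
        using bound[OF m] True by (intro mult_minplus_mono monic_fun_le)
          (simp add: plus_minplus_eq_min min.coboundedI2)
      with True show ?thesis
        by simp
    next
      case False
      then obtain j where j: "m = Suc j" "j \<in> {1..n}"
        using m by (cases m) auto
      have "(x + \<mu>) * ?q \<le> \<mu> * (d j * x ^ (n - j))"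
        using j by (intro mult_minplus_mono monic_fun_le) auto
      also have "\<dots> = c m * x ^ (Suc n - m)"
        using j(1) by (simp flip: d(1)[OF j(2)] add: mult_ac)
      finally show ?thesis .
    qed
    ultimately show "(x + \<mu>) * ?q \<le> monic_fun (Suc n) c x"
      by (simp add: le_monic_fun_iff del: power_Suc)
  qed
  then show ?thesis
    by blast
qed

theorem minplus_fundamental_theorem_of_algebra:
  "\<exists>R. size R = n \<and> (\<forall>x. monic_fun n c x = (\<Prod>r\<in>#R. x + r))"
proof (induction n arbitrary: c)
  case 0
  show ?case
    by (intro exI[of _ "{#}"]) (simp add: monic_fun_def)
next
  case (Suc n)
  obtain \<mu> where "least_mean c (Suc n) \<mu>"
    using least_mean_exists[of "Suc n"] by auto
  then obtain d where d: "\<forall>x. monic_fun (Suc n) c x = (x + \<mu>) * monic_fun n d x"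
    using split_off_least_root by blast
  obtain R where "size R = n" "\<forall>x. monic_fun n d x = (\<Prod>r\<in>#R. x + r)"
    using Suc.IH by blast
  with d show ?case
    by (intro exI[of _ "add_mset \<mu> R"]) simp
qed

lemma prod_mset_minplus_le_power: "(\<Prod>r\<in>#R. x + r) \<le> (x :: minplus) ^ size R"
  by (induction R) (auto intro!: mult_minplus_mono)

text \<open>
  A linear factor \<open>x + r\<close> drops below \<open>x\<close> at every point \<open>x\<close> beyond \<open>r\<close>, so a root \<open>r < \<mu>\<close>
  would make the product smaller than \<open>x ^ n\<close> between \<open>r\<close> and \<open>\<mu>\<close>, where the leading term
  is still the smallest.
\<close>

lemma least_mean_le_root:
  assumes \<mu>: "least_mean c n \<mu>"
    and R: "size R = n" "\<forall>x. monic_fun n c x = (\<Prod>r\<in>#R. x + r)" "r \<in># R"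
  shows "\<mu> \<le> r"
proof (rule ccontr)
  assume "\<not> \<mu> \<le> r"
  then have "r < \<mu>"
    by simp
  then obtain x where x: "r < x" "x < \<mu>"
    using minplus_dense by blast
  then have "x \<noteq> 0"
    using leD[OF le_zero_minplus[of \<mu>]] by auto
  obtain R' where R': "R = add_mset r R'"
    using R(3) by (metis multi_member_split)
  have "x ^ n \<le> monic_fun n c x"
    unfolding le_monic_fun_iff
  proof safe
    fix m assume m: "m \<in> {1..n}"
    have "x ^ m * x ^ (n - m) \<le> c m * x ^ (n - m)"
    proof (rule mult_minplus_mono)
      have "x ^ m \<le> \<mu> ^ m"
        using x by (intro power_minplus_mono) simp
      also have "\<mu> ^ m \<le> c m"
        using \<mu> m by (simp add: least_mean_def)
      finally show "x ^ m \<le> c m" .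
    qed simp
    then show "x ^ n \<le> c m * x ^ (n - m)"
      using m by (simp flip: power_add)
  qed
  also have "monic_fun n c x = (x + r) * (\<Prod>s\<in>#R'. x + s)"
    using R(2) R' by simp
  also have "\<dots> \<le> r * x ^ size R'"
    by (intro mult_minplus_mono prod_mset_minplus_le_power) simp
  finally have "x * x ^ size R' \<le> r * x ^ size R'"
    by (simp flip: R(1) add: R')
  then have "x \<le> r"
    using \<open>x \<noteq> 0\<close> by (intro mult_minplus_cancel[of x "x ^ size R'"]) auto
  with x show False
    by simp
qed

theorem minimum_root_eq_least_mean:
  assumes n: "degree p = n" "n \<ge> 1" and p: "\<And>x. poly p x = monic_fun n c x"
    and \<mu>: "least_mean c n \<mu>"
  shows "is_minimum {r. root_of p r} \<mu>"
proof -
  obtain k where k: "n = Suc k"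
    using n(2) by (cases n) auto
  obtain d where d: "\<forall>x. monic_fun n c x = (x + \<mu>) * monic_fun k d x"
    using split_off_least_root \<mu> unfolding k by blast
  obtain R where R: "size R = k" "\<forall>x. monic_fun k d x = (\<Prod>r\<in>#R. x + r)"
    using minplus_fundamental_theorem_of_algebra by blast
  have "linear_factorization p (add_mset \<mu> R)"
    using d R n k p by (simp add: linear_factorization_def)
  then have "root_of p \<mu>"
    unfolding root_of_def by (intro exI[of _ "add_mset \<mu> R"]) simp
  moreover have "\<mu> \<le> r" if "root_of p r" for r
    using that least_mean_le_root[OF \<mu>] n p
    by (auto simp: root_of_def linear_factorization_def)
  ultimately show ?thesis
    by (simp add: is_minimum_def)
qed

section \<open>Trace coefficients\<close>

lemma trace_sum: "trace (\<Sum>k\<in>S. f k) = (\<Sum>k\<in>S. trace (f k :: minplus ^ 'n ^ 'n))"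
  unfolding trace_def sum_component by (rule sum.swap)

lemma trace_scale_matrix: "trace (scale_matrix a M) = a * trace M"
  by (simp add: trace_def scale_matrix_def sum_distrib_left)

lemma trace_coeff_recursion:
  "trace_coeff A m = trace (matrix_power A m)
     + (\<Sum>k = 1..<m. trace_coeff A k * trace (matrix_power A (m - k)))"
proof -
  have "trace (M + N) = trace M + trace N" for M N :: "minplus ^ 'a ^ 'a"
    by (simp add: trace_def sum.distrib)
  then show ?thesis
    by (subst trace_coeff.simps) (simp add: trace_sum trace_scale_matrix)
qed

text \<open>
  The coefficient with index \<open>m\<close> is the least sum of traces over all compositions of \<open>m\<close>, and
  the bound \<open>\<mu> ^ k \<le> trace (matrix_power A k)\<close> adds up along a composition.
  The composition with a single part attains it.
\<close>

lemma least_mean_trace_coeff: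
  assumes "least_mean (\<lambda>m. trace (matrix_power A m)) n \<mu>"
  shows "least_mean (trace_coeff A) n \<mu>"
proof -
  have tr: "\<mu> ^ m \<le> trace (matrix_power A m)" if "m \<in> {1..n}" for m
    using assms that by (auto simp: least_mean_def)
  have co: "\<mu> ^ m \<le> trace_coeff A m" if "m \<in> {1..n}" for m
    using that
  proof (induction m rule: less_induct)
    case (less m)
    have "\<mu> ^ m \<le> trace_coeff A k * trace (matrix_power A (m - k))" if k: "k \<in> {1..<m}" for k
    proof -
      have "\<mu> ^ k * \<mu> ^ (m - k) \<le> trace_coeff A k * trace (matrix_power A (m - k))"
        using k less.prems by (intro mult_minplus_mono less.IH tr) auto
      then show ?thesis
        using k by (simp flip: power_add)
    qed
    then show ?case
      using tr[OF less.prems] by (subst trace_coeff_recursion) (simp add: le_minplus_sum_iff)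
  qed
  obtain m where m: "m \<in> {1..n}" "\<mu> ^ m = trace (matrix_power A m)"
    using assms by (auto simp: least_mean_def)
  have "trace_coeff A m \<le> \<mu> ^ m"
    unfolding m(2) by (subst trace_coeff_recursion) simp
  with co m(1) show ?thesis
    unfolding least_mean_def by (metis antisym)
qed

lemma poly_trace_poly:
  "poly (trace_poly A) x = monic_fun CARD('n) (trace_coeff A) x"
  for A :: "minplus ^ 'n ^ 'n"
  by (simp add: trace_poly_def monic_fun_def poly_sum poly_monom)

lemma degree_trace_poly: "degree (trace_poly A) = CARD('n)"
  for A :: "minplus ^ 'n ^ 'n"
proof (rule antisym)
  show "degree (trace_poly A) \<le> CARD('n)"
    unfolding trace_poly_def
    by (intro degree_add_le degree_sum_le degree_monom_le[THEN order_trans]) auto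
  have "(\<Sum>m = 1..CARD('n). coeff (monom (trace_coeff A m) (CARD('n) - m)) CARD('n)) = 0"
    by (intro sum.neutral) auto
  then have "coeff (trace_poly A) CARD('n) = 1"
    by (simp add: trace_poly_def coeff_sum)
  then show "CARD('n) \<le> degree (trace_poly A)"
    by (intro le_degree) simp
qed

section \<open>Walks and powers of a matrix\<close>

lemma matrix_power_add: "matrix_power A (j + k) = matrix_power A j ** matrix_power A k"
  by (induction k) (simp_all add: matrix_mul_assoc)

lemma matrix_mult_le: "(M ** N) $ i $ j \<le> M $ i $ l * N $ l $ (j :: 'n :: finite)"
  for M N :: "minplus ^ 'n ^ 'n"
  using minplus_sum_le[of UNIV l "\<lambda>l. M $ i $ l * N $ l $ j"]
  by (simp add: matrix_matrix_mult_def)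

lemma closed_walk_ge_least_mean:
  assumes "least_mean (\<lambda>m. trace (matrix_power A m)) n \<mu>" "1 \<le> m" "m \<le> n"
  shows "\<mu> ^ m \<le> matrix_power A m $ i $ i"
proof -
  have "\<mu> ^ m \<le> trace (matrix_power A m)"
    using assms by (simp add: least_mean_def)
  also have "\<dots> \<le> matrix_power A m $ i $ i"
    using minplus_sum_le[of UNIV i "\<lambda>i. matrix_power A m $ i $ i"] by (simp add: trace_def)
  finally show ?thesis .
qed

lemma matrix_power_le_walk:
  fixes A :: "minplus ^ 'n ^ 'n"
  assumes "p \<le> q"
  shows "matrix_power A (q - p) $ v p $ v q \<le> (\<Prod>l = p..<q. A $ v l $ v (Suc l))"
  using assms
proof (induction q rule: dec_induct)
  case base
  show ?case
    by (simp add: mat_def)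
next
  case (step q)
  have "matrix_power A (Suc q - p) $ v p $ v (Suc q)
      \<le> matrix_power A (q - p) $ v p $ v q * A $ v q $ v (Suc q)"
    using step.hyps matrix_mult_le by (simp add: Suc_diff_le)
  also have "\<dots> \<le> (\<Prod>l = p..<Suc q. A $ v l $ v (Suc l))"
    using step by (simp add: mult_minplus_mono)
  finally show ?case .
qed

lemma matrix_power_attained_by_walk:
  fixes A :: "minplus ^ 'n ^ 'n"
  shows "\<exists>v. v 0 = i \<and> v (Suc k) = j \<and>
    matrix_power A (Suc k) $ i $ j = (\<Prod>l = 0..<Suc k. A $ v l $ v (Suc l))"
proof (induction k arbitrary: j)
  case 0
  show ?case
    by (intro exI[of _ "\<lambda>l. if l = 0 then i else j"]) simp
next
  case (Suc k)
  obtain l where l: "matrix_power A (Suc (Suc k)) $ i $ j = matrix_power A (Suc k) $ i $ l * A $ l $ j"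
    using minplus_sum_attained[of UNIV "\<lambda>l. matrix_power A (Suc k) $ i $ l * A $ l $ j"]
    unfolding matrix_power.simps(2)[of A "Suc k"] matrix_matrix_mult_def[of _ A] by auto
  obtain v where v: "v 0 = i" "v (Suc k) = l"
    "matrix_power A (Suc k) $ i $ l = (\<Prod>l = 0..<Suc k. A $ v l $ v (Suc l))"
    using Suc.IH by blast
  define w where "w = v(Suc (Suc k) := j)"
  have "(\<Prod>l = 0..<Suc k. A $ w l $ w (Suc l)) = (\<Prod>l = 0..<Suc k. A $ v l $ v (Suc l))"
    by (intro prod.cong) (auto simp: w_def)
  then show ?case
    using v l by (intro exI[of _ w]) (simp add: w_def del: matrix_power.simps)
qed

lemma walk_revisits_vertex:
  fixes v :: "nat \<Rightarrow> 'n :: finite"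
  shows "\<exists>p q. p < q \<and> q \<le> CARD('n) \<and> v p = v q"
proof -
  have "card (v ` {..CARD('n)}) \<le> CARD('n)"
    by (rule card_mono) auto
  then have "\<not> inj_on v {..CARD('n)}"
    by (intro pigeonhole) simp
  then obtain p q where "p \<le> CARD('n)" "q \<le> CARD('n)" "p \<noteq> q" "v p = v q"
    by (auto simp: inj_on_def)
  then show ?thesis
    by (metis linorder_neqE_nat)
qed

section \<open>Eigenvalues\<close>

text \<open>
  A walk with one step more than there are vertices contains a closed subwalk that can be cut
  out, and whose weight is at least its length times \<open>\<mu>\<close>. The additional step ensures that
  the remaining walk is not empty.
\<close>

lemma long_walk_shortening:
  fixes A :: "minplus ^ 'n ^ 'n"
  assumes \<mu>: "least_mean (\<lambda>m. trace (matrix_power A m)) CARD('n) \<mu>"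
  shows "\<exists>k\<in>{1..CARD('n)}.
    \<mu> ^ (Suc CARD('n) - k) * matrix_power A k $ i $ j \<le> matrix_power A (Suc CARD('n)) $ i $ j"
proof -
  let ?n = "CARD('n)"
  obtain v where v: "v 0 = i" "v (Suc ?n) = j"
    "matrix_power A (Suc ?n) $ i $ j = (\<Prod>l = 0..<Suc ?n. A $ v l $ v (Suc l))"
    using matrix_power_attained_by_walk[where k = "?n"] by blast
  obtain p q where pq: "p < q" "q \<le> ?n" "v p = v q"
    using walk_revisits_vertex by blast
  let ?w = "\<lambda>a b. \<Prod>l = a..<b. A $ v l $ v (Suc l)"
  define k where "k = p + (Suc ?n - q)"
  have k: "k \<in> {1..?n}" "Suc ?n - k = q - p"
    using pq by (auto simp: k_def)
  have "\<mu> ^ (q - p) \<le> matrix_power A (q - p) $ v p $ v q"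
    using closed_walk_ge_least_mean[OF \<mu>, of "q - p" "v p"] pq by simp
  also have "\<dots> \<le> ?w p q"
    using pq by (intro matrix_power_le_walk) simp
  finally have cyc: "\<mu> ^ (q - p) \<le> ?w p q" .
  have "matrix_power A k $ i $ j
      \<le> matrix_power A (p - 0) $ v 0 $ v p * matrix_power A (Suc ?n - q) $ v q $ v (Suc ?n)"
    unfolding k_def matrix_power_add using v(1,2) pq(3) matrix_mult_le by simp
  also have "\<dots> \<le> ?w 0 p * ?w q (Suc ?n)"
    using pq by (intro mult_minplus_mono matrix_power_le_walk) auto
  finally have "\<mu> ^ (q - p) * matrix_power A k $ i $ j \<le> ?w p q * (?w 0 p * ?w q (Suc ?n))"
    using cyc by (rule mult_minplus_mono[rotated])
  also have "\<dots> = ?w 0 p * ?w p q * ?w q (Suc ?n)"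
    by (simp only: mult_ac)
  also have "\<dots> = ?w 0 (Suc ?n)"
    using pq by (simp add: prod.atLeastLessThan_concat del: prod.op_ivl_Suc)
  finally show ?thesis
    using v(3) k by (intro bexI[of _ k]) simp_all
qed

text \<open>
  If \<open>\<mu>\<close> is finite, some vertex \<open>i\<close> lies on a closed walk of mean weight \<open>\<mu>\<close>. After subtracting
  \<open>\<mu>\<close> from all entries of \<open>A\<close>, an eigenvector for the real number zero is given by the
  distances to \<open>i\<close> along nonempty walks: extending these by one step loses only the walks with a single
  step, which the closed walk through \<open>i\<close> makes up for, and gains only walks that can be
  shortened. The exponents of \<open>\<mu>\<close> in the definition of \<open>x\<close> express the subtraction without
  inverses, up to the common factor \<open>\<mu> ^ CARD('n)\<close>.
\<close>

lemma finite_least_mean_eigenvalue: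
  fixes A :: "minplus ^ 'n ^ 'n"
  assumes \<mu>: "least_mean (\<lambda>m. trace (matrix_power A m)) CARD('n) \<mu>" and "\<mu> \<noteq> 0"
  shows "eigenvalue A \<mu>"
proof -
  let ?n = "CARD('n)"
  obtain m where m: "m \<in> {1..?n}" "\<mu> ^ m = trace (matrix_power A m)"
    using \<mu> by (auto simp: least_mean_def)
  obtain i where i: "matrix_power A m $ i $ i = \<mu> ^ m"
    using minplus_sum_attained[of UNIV "\<lambda>i. matrix_power A m $ i $ i"] m(2)
    unfolding trace_def by auto
  define x :: "minplus ^ 'n" where "x = (\<chi> j. \<Sum>k = 1..?n. \<mu> ^ (?n - k) * matrix_power A k $ j $ i)"
  have "(A *v x) $ j = (\<mu> *s x) $ j" for j
  proof -
    let ?S = "\<lambda>k. matrix_power A k $ j $ i"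
    have A_power: "?S (Suc k) = (\<Sum>l\<in>UNIV. A $ j $ l * matrix_power A k $ l $ i)" for k
      using matrix_power_add[of A 1 k, unfolded matrix_power_1]
      by (simp add: matrix_matrix_mult_def del: matrix_power.simps)
    have "(A *v x) $ j = (\<Sum>k = 1..?n. \<mu> ^ (?n - k) * ?S (Suc k))" (is "_ = ?lhs")
      unfolding A_power x_def matrix_vector_mult_def
      by (simp add: sum_distrib_left mult_ac sum.swap[of _ "{Suc 0..?n}" UNIV])
    moreover have "(\<mu> *s x) $ j = (\<Sum>k = 1..?n. \<mu> ^ (Suc ?n - k) * ?S k)" (is "_ = ?rhs")
      unfolding x_def vector_scalar_mult_def
      by (simp add: sum_distrib_left Suc_diff_le mult_ac)
    moreover have "?lhs = ?rhs"
    proof (rule antisym)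
      have "?lhs \<le> \<mu> ^ (Suc ?n - k) * ?S k" if k: "k \<in> {1..?n}" for k
      proof (cases "k = 1")
        case True
        have "?lhs \<le> \<mu> ^ (?n - m) * ?S (1 + m)"
          using minplus_sum_le[of "{1..?n}" m] m(1) by simp
        also have "\<dots> \<le> \<mu> ^ (?n - m) * (A $ j $ i * \<mu> ^ m)"
          unfolding matrix_power_add i[symmetric]
          using matrix_mult_le[of A "matrix_power A m"] by (intro mult_minplus_mono) simp_all
        also have "\<dots> = (\<mu> ^ (?n - m) * \<mu> ^ m) * A $ j $ i"
          by (simp only: mult_ac)
        also have "\<dots> = \<mu> ^ (Suc ?n - k) * ?S k"
          using True m(1) by (simp flip: power_add)
        finally show ?thesis .
      next
        case False
        then obtain l where l: "k = Suc l" "l \<in> {1..?n}"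
          using k by (cases k) auto
        then show ?thesis
          using minplus_sum_le[of "{1..?n}" l "\<lambda>k. \<mu> ^ (?n - k) * ?S (Suc k)"]
          by (simp del: matrix_power.simps)
      qed
      then show "?lhs \<le> ?rhs"
        by (simp add: le_minplus_sum_iff)
    next
      have rhs_le: "?rhs \<le> \<mu> ^ (Suc ?n - k) * ?S k" if "k \<in> {1..?n}" for k
        using that by (intro minplus_sum_le) auto
      have "?rhs \<le> \<mu> ^ (?n - k) * ?S (Suc k)" if k: "k \<in> {1..?n}" for k
      proof (cases "k = ?n")
        case True
        obtain l where l: "l \<in> {1..?n}" "\<mu> ^ (Suc ?n - l) * ?S l \<le> ?S (Suc ?n)"
          using long_walk_shortening[OF \<mu>] by blast
        have "?rhs \<le> ?S (Suc ?n)"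
          using rhs_le[OF l(1)] l(2) by (rule order_trans)
        with True show ?thesis
          by (simp del: matrix_power.simps)
      next
        case False
        then show ?thesis
          using rhs_le[of "Suc k"] k by (simp del: matrix_power.simps)
      qed
      then show "?rhs \<le> ?lhs"
        by (simp add: le_minplus_sum_iff)
    qed
    ultimately show ?thesis
      by simp
  qed
  then have "A *v x = \<mu> *s x"
    by (simp add: vec_eq_iff)
  moreover have "x \<noteq> 0"
  proof
    assume "x = 0"
    then have "x $ i = 0"
      by simp
    then have "(\<Sum>k = 1..?n. \<mu> ^ (?n - k) * matrix_power A k $ i $ i) = 0"
      by (simp add: x_def)
    then have "0 \<le> \<mu> ^ (?n - m) * matrix_power A m $ i $ i"
      using minplus_sum_le[of "{1..?n}" m "\<lambda>k. \<mu> ^ (?n - k) * matrix_power A k $ i $ i"] m(1)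
      by simp
    with \<open>\<mu> \<noteq> 0\<close> i show False
      by simp
  qed
  ultimately show ?thesis
    unfolding eigenvalue_def by blast
qed

text \<open>
  Infinite closed walk weights mean that there are no cycles, and in an acyclic digraph some
  vertex has no predecessor, for otherwise one could walk backwards until a vertex repeats.
  The corresponding unit vector is an eigenvector.
\<close>

lemma infinite_least_mean_eigenvalue:
  fixes A :: "minplus ^ 'n ^ 'n"
  assumes \<mu>: "least_mean (\<lambda>m. trace (matrix_power A m)) CARD('n) 0"
  shows "eigenvalue A 0"
proof -
  let ?n = "CARD('n)"
  have "\<exists>j. \<forall>i. A $ i $ j = 0"
  proof (rule ccontr)
    assume "\<not> ?thesis"
    then obtain f where f: "A $ f j $ j \<noteq> 0" for j
      by metis
    \<comment> \<open>The edges lead from \<open>f j\<close> to \<open>j\<close>, so the iterates are numbered downwards; any start will do.\<close>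
    define v where "v l = (f ^^ (?n - l)) undefined" for l
    have step: "A $ v l $ v (Suc l) \<noteq> 0" if "l < ?n" for l
    proof -
      have "?n - l = Suc (?n - Suc l)"
        using that by simp
      then have "v l = f (v (Suc l))"
        by (simp add: v_def)
      then show ?thesis
        using f by simp
    qed
    obtain p q where pq: "p < q" "q \<le> ?n" "v p = v q"
      using walk_revisits_vertex by blast
    have "0 \<le> matrix_power A (q - p) $ v p $ v q"
      using closed_walk_ge_least_mean[OF \<mu>, of "q - p" "v p"] pq by (simp add: power_0_left)
    also have "\<dots> \<le> (\<Prod>l = p..<q. A $ v l $ v (Suc l))"
      using pq by (intro matrix_power_le_walk) simp
    finally have "(\<Prod>l = p..<q. A $ v l $ v (Suc l)) = 0"
      by simp
    then show False
      using minplus_prod_nonzero[of "{p..<q}" "\<lambda>l. A $ v l $ v (Suc l)"] step pq(2) by simp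
  qed
  then obtain j where j: "A $ i $ j = 0" for i
    by blast
  have "A *v axis j 1 = 0 *s axis j 1"
    by (auto simp: vec_eq_iff matrix_vector_mult_def axis_def j intro!: sum.neutral)
  moreover have "axis j 1 \<noteq> (0 :: minplus ^ 'n)"
    by (simp add: axis_eq_0_iff)
  ultimately show ?thesis
    unfolding eigenvalue_def by blast
qed

text \<open>
  In the eigenvalue equation for a finite \<open>l\<close> each finite entry of the eigenvector is attained at
  another finite entry. Following these entries leads into a closed walk, whose mean weight is
  exactly \<open>l\<close>.
\<close>

lemma least_mean_le_eigenvalue:
  fixes A :: "minplus ^ 'n ^ 'n"
  assumes \<mu>: "least_mean (\<lambda>m. trace (matrix_power A m)) CARD('n) \<mu>" and "eigenvalue A l"
  shows "\<mu> \<le> l"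
proof (cases "l = 0")
  case False
  obtain x where x: "x \<noteq> 0" "A *v x = l *s x"
    using assms(2) by (auto simp: eigenvalue_def)
  have "\<exists>j. A $ i $ j * x $ j = l * x $ i" for i
    using minplus_sum_attained[of UNIV "\<lambda>j. A $ i $ j * x $ j"] x(2)
    by (auto simp: vec_eq_iff matrix_vector_mult_def)
  then obtain f where f: "A $ i $ f i * x $ f i = l * x $ i" for i
    by metis
  obtain i where i: "x $ i \<noteq> 0"
    using x(1) by (auto simp: vec_eq_iff)
  define v where "v k = (f ^^ k) i" for k
  have v_Suc: "v (Suc k) = f (v k)" for k
    by (simp add: v_def)
  have x_v: "x $ v k \<noteq> 0" for k
  proof (induction k)
    case 0
    show ?case
      using i by (simp add: v_def)
  next
    case (Suc k)
    with f[of "v k"] False show ?case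
      by (auto simp: v_Suc)
  qed
  obtain p q where pq: "p < q" "q \<le> CARD('n)" "v p = v q"
    using walk_revisits_vertex by blast
  have weight: "(\<Prod>k = p..<r. A $ v k $ v (Suc k)) * x $ v r = l ^ (r - p) * x $ v p"
    if "p \<le> r" for r
    using that
  proof (induction r rule: dec_induct)
    case base
    show ?case
      by simp
  next
    case (step r)
    have "(\<Prod>k = p..<Suc r. A $ v k $ v (Suc k)) * x $ v (Suc r)
        = (\<Prod>k = p..<r. A $ v k $ v (Suc k)) * (A $ v r $ f (v r) * x $ f (v r))"
      using step.hyps by (simp add: v_Suc mult.assoc)
    also have "\<dots> = l * ((\<Prod>k = p..<r. A $ v k $ v (Suc k)) * x $ v r)"
      unfolding f by (simp only: mult_ac)
    also have "\<dots> = l ^ (Suc r - p) * x $ v p"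
      using step by (simp add: Suc_diff_le mult.assoc)
    finally show ?case .
  qed
  have "\<mu> ^ (q - p) \<le> matrix_power A (q - p) $ v p $ v q"
    using closed_walk_ge_least_mean[OF \<mu>, of "q - p" "v p"] pq by simp
  also have "\<dots> \<le> (\<Prod>k = p..<q. A $ v k $ v (Suc k))"
    using pq by (intro matrix_power_le_walk) simp
  also have "\<dots> \<le> l ^ (q - p)"
  proof (rule mult_minplus_cancel)
    show "(\<Prod>k = p..<q. A $ v k $ v (Suc k)) * x $ v q \<le> l ^ (q - p) * x $ v q"
      using weight[OF less_imp_le[OF pq(1)]] unfolding pq(3) by (rule eq_refl)
  qed (rule x_v)
  finally show ?thesis
    using pq by (intro power_minplus_cancel[of \<mu> "q - p"]) auto
qed simp

theorem minimum_eigenvalue_eq_least_mean: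
  fixes A :: "minplus ^ 'n ^ 'n"
  assumes "least_mean (\<lambda>m. trace (matrix_power A m)) CARD('n) \<mu>"
  shows "is_minimum {l. eigenvalue A l} \<mu>"
proof -
  have "eigenvalue A \<mu>"
    using assms finite_least_mean_eigenvalue[of A \<mu>] infinite_least_mean_eigenvalue[of A]
    by (cases "\<mu> = 0") simp_all
  then show ?thesis
    using least_mean_le_eigenvalue[OF assms] by (simp add: is_minimum_def)
qed

section \<open>The minimum root is the minimum eigenvalue\<close>

theorem theorem6p2:
  fixes A :: "minplus ^ 'n ^ 'n"
  shows "\<exists>\<mu>. is_minimum {r. root_of (trace_poly A) r} \<mu> \<and> is_minimum {l. eigenvalue A l} \<mu>"
proof -
  have card: "CARD('n) \<ge> 1"
    by (simp add: Suc_leI)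
  then obtain \<mu> where \<mu>: "least_mean (\<lambda>m. trace (matrix_power A m)) CARD('n) \<mu>"
    using least_mean_exists by blast
  have "is_minimum {r. root_of (trace_poly A) r} \<mu>"
    using minimum_root_eq_least_mean[OF degree_trace_poly card poly_trace_poly]
      least_mean_trace_coeff[OF \<mu>] .
  with minimum_eigenvalue_eq_least_mean[OF \<mu>] show ?thesis
    by blast
qed

end
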